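(* For every target graph $H$ (connected, with at least three nodes, of constant size) satisfying $\operatorname{diam}(H) = 2$ and $\operatorname{rad}(H) = 1$, there is a deterministic one-round algorithm with bandwidth $O(1)$ for $\textsc{MemDetect}(H)$ under node deletions.
   Context: $\operatorname{diam}(H)$ and $\operatorname{rad}(H)$ are the diameter and radius (minimum eccentricity) of $H$. Dynamic network model: a sequence of graphs $G^0, G^1, \ldots$ with $n$ nodes initially, each obtained from the previous by at most one node deletion; nodes have distinct IDs, know their neighbors' IDs and initially the whole of $G^0$; communication is synchronous, each round the change happens first, then each node sends a $B$-bit message to each neighbor; nodes detect changes only via their neighbor lists. A one-round algorithm must output correctly for the current graph at the end of each round. $\textsc{MemDetect}(H)$: each node $v$ outputs whether $v$ belongs to some subgraph of the current graph isomorphic to $H$. *)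

theory Defs
  imports "HOL-Library.Extended_Nat"
begin

section \<open>Simple graphs\<close>

record 'a ugraph =
  verts :: "'a set"
  edges :: "'a set set"

definition simple_graph :: "'a ugraph \<Rightarrow> bool" where
  "simple_graph G \<longleftrightarrow> finite (verts G) \<and>
     edges G \<subseteq> {{u, v} | u v. u \<in> verts G \<and> v \<in> verts G \<and> u \<noteq> v}"

definition nbrs :: "'a ugraph \<Rightarrow> 'a \<Rightarrow> 'a set" where
  "nbrs G v = {u. {v, u} \<in> edges G}"

definition subgraph :: "'a ugraph \<Rightarrow> 'a ugraph \<Rightarrow> bool" where
  "subgraph K G \<longleftrightarrow> simple_graph K \<and> verts K \<subseteq> verts G \<and> edges K \<subseteq> edges G"

definition isomorphic :: "'a ugraph \<Rightarrow> 'b ugraph \<Rightarrow> bool" where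
  "isomorphic G H \<longleftrightarrow>
     (\<exists>f. bij_betw f (verts G) (verts H) \<and>
          (\<forall>u\<in>verts G. \<forall>v\<in>verts G. {u, v} \<in> edges G \<longleftrightarrow> {f u, f v} \<in> edges H))"

definition delete_vertex :: "'a ugraph \<Rightarrow> 'a \<Rightarrow> 'a ugraph" where
  "delete_vertex G w = \<lparr>verts = verts G - {w}, edges = {e \<in> edges G. w \<notin> e}\<rparr>"

text \<open>A walk is given by its nonempty list of vertices, so its length as a walk is one less
  than the length of that list.\<close>

definition walks :: "'a ugraph \<Rightarrow> 'a \<Rightarrow> 'a \<Rightarrow> 'a list set" where
  "walks G u v = {p. p \<noteq> [] \<and> hd p = u \<and> last p = v \<and> set p \<subseteq> verts G \<and>
     successively (\<lambda>x y. {x, y} \<in> edges G) p}"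

definition connected_graph :: "'a ugraph \<Rightarrow> bool" where
  "connected_graph G \<longleftrightarrow> verts G \<noteq> {} \<and>
     (\<forall>u\<in>verts G. \<forall>v\<in>verts G. walks G u v \<noteq> {})"

text \<open>The distance is \<open>\<infinity>\<close> if there is no walk, since the infimum of the empty set of
  extended naturals is \<open>\<infinity>\<close>.\<close>

definition graph_dist :: "'a ugraph \<Rightarrow> 'a \<Rightarrow> 'a \<Rightarrow> enat" where
  "graph_dist G u v = (INF p\<in>walks G u v. enat (length p - 1))"

definition ecc :: "'a ugraph \<Rightarrow> 'a \<Rightarrow> enat" where
  "ecc G v = (SUP u\<in>verts G. graph_dist G v u)"

definition diam :: "'a ugraph \<Rightarrow> enat" where
  "diam G = (SUP v\<in>verts G. ecc G v)"

definition rad :: "'a ugraph \<Rightarrow> enat" where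
  "rad G = (INF v\<in>verts G. ecc G v)"


section \<open>Dynamic networks under node deletions\<close>

text \<open>Nodes are identified with their IDs, which are natural numbers.\<close>

definition node_deletion_network :: "(nat \<Rightarrow> nat ugraph) \<Rightarrow> bool" where
  "node_deletion_network G \<longleftrightarrow> simple_graph (G 0) \<and>
     (\<forall>i. G (Suc i) = G i \<or> (\<exists>w\<in>verts (G i). G (Suc i) = delete_vertex (G i) w))"

type_synonym message = "bool list"

text \<open>What a node observes in one round: its current neighbor list, and the message received
  from each of these neighbors (\<open>None\<close> for all other IDs). A history lists the observations of
  the rounds completed so far, the earliest first.\<close>

type_synonym observation = "nat set \<times> (nat \<Rightarrow> message option)"
type_synonym history = "observation list"

text \<open>A deterministic algorithm is given by functions of everything a node knows, with no
  restriction on local memory or computation; any algorithm that keeps a local state is of this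
  form, because its state is a function of these arguments.

  \<open>send A v G0 h N u\<close> is the message that the node with ID \<open>v\<close> sends to its neighbor \<open>u\<close>, where
  \<open>G0\<close> is the initial graph, \<open>h\<close> the history of \<open>v\<close> in the previous rounds, and \<open>N\<close> the neighbor
  list of \<open>v\<close> after the change of the current round.

  \<open>result A v G0 h\<close> is the output of \<open>v\<close> at the end of a round, where the history \<open>h\<close> includes
  that round.\<close>

record algorithm =
  send :: "nat \<Rightarrow> nat ugraph \<Rightarrow> history \<Rightarrow> nat set \<Rightarrow> nat \<Rightarrow> message"
  result :: "nat \<Rightarrow> nat ugraph \<Rightarrow> history \<Rightarrow> bool"

text \<open>Round \<open>Suc i\<close> starts with the change from \<open>G i\<close> to \<open>G (Suc i)\<close>; the messages are then
  exchanged along the edges of \<open>G (Suc i)\<close>.\<close>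

fun history_of :: "algorithm \<Rightarrow> (nat \<Rightarrow> nat ugraph) \<Rightarrow> nat \<Rightarrow> nat \<Rightarrow> history" where
  "history_of A G 0 v = []"
| "history_of A G (Suc i) v = history_of A G i v @
     [(nbrs (G (Suc i)) v,
       \<lambda>u. if u \<in> nbrs (G (Suc i)) v
           then Some (send A u (G 0) (history_of A G i u) (nbrs (G (Suc i)) u) v)
           else None)]"

definition has_bandwidth :: "algorithm \<Rightarrow> nat \<Rightarrow> bool" where
  "has_bandwidth A B \<longleftrightarrow> (\<forall>v G0 h N u. length (send A v G0 h N u) = B)"

text \<open>A problem prescribes the correct output of each node in each graph. Outputs are required
  from the nodes still present, at the end of every round \<open>i \<ge> 1\<close>, for the graph \<open>G i\<close> of that
  same round.\<close>

definition one_round_solves :: "algorithm \<Rightarrow> (nat ugraph \<Rightarrow> nat \<Rightarrow> bool) \<Rightarrow> bool" where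
  "one_round_solves A P \<longleftrightarrow>
     (\<forall>G. node_deletion_network G \<longrightarrow>
       (\<forall>i\<ge>1. \<forall>v\<in>verts (G i). result A v (G 0) (history_of A G i v) \<longleftrightarrow> P (G i) v))"

definition MemDetect :: "'a ugraph \<Rightarrow> nat ugraph \<Rightarrow> nat \<Rightarrow> bool" where
  "MemDetect H G v \<longleftrightarrow> (\<exists>K. subgraph K G \<and> isomorphic K H \<and> v \<in> verts K)"

end

theory Submission
  imports Defs
begin

text \<open>A graph of radius 1 has a vertex adjacent to all others, so every copy of it in the current
  graph lies in the closed neighborhood of a single node \<open>c\<close>. Under deletions the current graph is
  always an induced subgraph of the initial one, hence \<open>c\<close> knows the graph induced on its closed
  neighborhood exactly and can tell each neighbor with one bit whether that neighbor belongs to a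
  copy lying there.\<close>

definition induced :: "'a ugraph \<Rightarrow> 'a set \<Rightarrow> 'a ugraph" where
  "induced G S = \<lparr>verts = verts G \<inter> S, edges = {e \<in> edges G. e \<subseteq> S}\<rparr>"

lemma edges_subset_verts:
  assumes "simple_graph G" "e \<in> edges G"
  shows "e \<subseteq> verts G"
  using assms unfolding simple_graph_def by auto

lemma induced_verts: "simple_graph G \<Longrightarrow> induced G (verts G) = G"
  using edges_subset_verts[of G] by (cases G) (auto simp: induced_def)

lemma simple_graph_induced: "simple_graph G \<Longrightarrow> simple_graph (induced G S)"
  unfolding simple_graph_def induced_def
  by (clarsimp simp: subset_iff Ball_def) (metis insertCI)

lemma induced_induced: "induced (induced G S) T = induced G (S \<inter> T)"
  by (auto simp: induced_def)

lemma delete_vertex_eq_induced: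
  "simple_graph G \<Longrightarrow> delete_vertex G w = induced G (verts G - {w})"
  using edges_subset_verts[of G] by (auto simp: induced_def delete_vertex_def)

text \<open>Each deletion restricts the graph to the remaining vertices, and nested restrictions
  compose by intersection. Edges between surviving nodes therefore never change, so knowing which
  nodes survive is enough to recover the current edges from \<open>G 0\<close>.\<close>

lemma network_induced:
  assumes "node_deletion_network G"
  shows "simple_graph (G i) \<and> G i = induced (G 0) (verts (G i))"
proof (induction i)
  case 0
  then show ?case
    using assms by (simp add: node_deletion_network_def induced_verts)
next
  case (Suc i)
  consider "G (Suc i) = G i" | w where "G (Suc i) = delete_vertex (G i) w"
    using assms unfolding node_deletion_network_def by blast
  then show ?case
  proof cases
    case 1
    then show ?thesis using Suc by simp
  next
    case 2
    have "G (Suc i) = induced (G i) (verts (G i) - {w})"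
      using 2 Suc delete_vertex_eq_induced by metis
    also have "\<dots> = induced (G 0) (verts (G i) \<inter> (verts (G i) - {w}))"
      using Suc induced_induced by metis
    also have "verts (G i) \<inter> (verts (G i) - {w}) = verts (G (Suc i))"
      using 2 by (auto simp: delete_vertex_def)
    finally have "G (Suc i) = induced (G 0) (verts (G (Suc i)))" .
    moreover have "simple_graph (G 0)"
      using assms by (simp add: node_deletion_network_def)
    ultimately show ?thesis
      using simple_graph_induced by metis
  qed
qed

lemma nbrs_subset_verts: "simple_graph G \<Longrightarrow> nbrs G v \<subseteq> verts G"
  using edges_subset_verts[of G] by (auto simp: nbrs_def)

text \<open>Copies of \<open>H\<close> need not be induced subgraphs, so a copy persists when more
  vertices are allowed.\<close>

lemma MemDetect_mono:
  assumes "MemDetect H (induced G S) v" "S \<subseteq> T"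
  shows "MemDetect H (induced G T) v"
proof -
  have "subgraph K (induced G T)" if "subgraph K (induced G S)" for K :: "nat ugraph"
    using that assms(2) unfolding subgraph_def induced_def by simp blast
  then show ?thesis
    using assms(1) unfolding MemDetect_def by blast
qed

lemma adjacent_if_ecc_le_1:
  assumes "ecc H c \<le> 1" "u \<in> verts H" "u \<noteq> c"
  shows "{c, u} \<in> edges H"
proof -
  have "graph_dist H c u \<le> 1"
    using assms(1,2) unfolding ecc_def by (meson SUP_le_iff)
  \<comment> \<open>The strict bound turns the infimum into a witness: an infimum below 2 means that
    some walk has length below 2.\<close>
  also have "(1::enat) < 2"
    by simp
  finally obtain p where p: "p \<in> walks H c u" "enat (length p - 1) < 2"
    unfolding graph_dist_def by (auto simp: INF_less_iff)
  have "length p \<le> 2"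
    using p(2) by (cases "length p") (auto simp: numeral_eq_enat)
  \<comment> \<open>Walks are nonempty lists, and a one-vertex walk would force
    \<open>u = c\<close>.\<close>
  then have "p = [c, u]"
    using p(1) assms(3)
    by (cases p rule: remdups_adj.cases) (auto simp: walks_def)
  then show ?thesis
    using p(1) by (simp add: walks_def)
qed

lemma universal_vertex_if_rad_1:
  assumes "rad H = 1"
  obtains c where "c \<in> verts H" "\<And>u. u \<in> verts H \<Longrightarrow> u \<noteq> c \<Longrightarrow> {c, u} \<in> edges H"
proof -
  have "rad H < 2"
    using assms by simp
  then obtain c where c: "c \<in> verts H" "ecc H c < 2"
    unfolding rad_def by (auto simp: INF_less_iff)
  have "ecc H c \<le> 1"
    using c(2) by (cases "ecc H c") (auto simp: numeral_eq_enat one_enat_def)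
  then show thesis
    using that c(1) adjacent_if_ecc_le_1 by metis
qed

text \<open>Take \<open>x\<close> to be the preimage, in a copy \<open>K\<close>, of a universal
  vertex of \<open>H\<close>. It is adjacent in \<open>K\<close> to all other vertices of
  \<open>K\<close>, so its closed neighborhood in \<open>G\<close> contains the whole copy.\<close>

lemma MemDetect_closed_nbhd:
  assumes "rad H = 1" "MemDetect H G v"
  obtains x where "v \<in> insert x (nbrs G x)" "MemDetect H (induced G (insert x (nbrs G x))) v"
proof -
  obtain c where c: "c \<in> verts H" "\<And>u. u \<in> verts H \<Longrightarrow> u \<noteq> c \<Longrightarrow> {c, u} \<in> edges H"
    using universal_vertex_if_rad_1[OF assms(1)] by metis
  obtain K where K: "subgraph K G" "isomorphic K H" "v \<in> verts K"
    using assms(2) unfolding MemDetect_def by blast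
  obtain f where f: "bij_betw f (verts K) (verts H)"
    "\<And>u w. u \<in> verts K \<Longrightarrow> w \<in> verts K \<Longrightarrow> {u, w} \<in> edges K \<longleftrightarrow> {f u, f w} \<in> edges H"
    using K(2) unfolding isomorphic_def by blast
  obtain x where x: "x \<in> verts K" "f x = c"
    using c(1) bij_betw_imp_surj_on[OF f(1)] by (metis imageE)
  let ?S = "insert x (nbrs G x)"
  have "{x, u} \<in> edges K" if "u \<in> verts K" "u \<noteq> x" for u
  proof -
    have "f u \<noteq> f x"
      using that x(1) f(1) by (auto simp: bij_betw_def inj_on_def)
    moreover have "f u \<in> verts H"
      using that f(1) by (auto simp: bij_betw_def)
    ultimately show ?thesis
      using c(2)[of "f u"] f(2)[of x u] x that by simp
  qed
  then have sub: "verts K \<subseteq> ?S"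
    using K(1) by (auto simp: subgraph_def nbrs_def)
  then have "subgraph K (induced G ?S)"
    using K(1) edges_subset_verts[of K] by (auto simp: subgraph_def induced_def)
  then have "MemDetect H (induced G ?S) v"
    using K(2,3) unfolding MemDetect_def by blast
  then show thesis
    using that sub K(3) by blast
qed

definition detect_alg :: "'a ugraph \<Rightarrow> algorithm" where
  "detect_alg H =
    \<lparr>send = (\<lambda>v G0 h N u. [MemDetect H (induced G0 (insert v N)) u]),
     result = (\<lambda>v G0 h. case last h of (N, m) \<Rightarrow>
       MemDetect H (induced G0 (insert v N)) v \<or> (\<exists>u\<in>N. m u = Some [True]))\<rparr>"

text \<open>The local check of \<open>v\<close> is the case \<open>x = v\<close>. Any other
  \<open>x\<close> is a neighbor whose bit was computed from its own neighbor list of the same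
  round, so the information is never one round old.\<close>

lemma result_detect_alg:
  "result (detect_alg H) v (G 0) (history_of (detect_alg H) G (Suc i) v) \<longleftrightarrow>
    (\<exists>x\<in>insert v (nbrs (G (Suc i)) v).
      MemDetect H (induced (G 0) (insert x (nbrs (G (Suc i)) x))) v)"
  by (simp add: detect_alg_def)

lemma detect_alg_correct:
  assumes "rad H = 1"
  shows "one_round_solves (detect_alg H) (MemDetect H)"
  unfolding one_round_solves_def
proof (intro allI impI ballI)
  fix G :: "nat \<Rightarrow> nat ugraph" and i v
  assume net: "node_deletion_network G" and i: "1 \<le> i" and v: "v \<in> verts (G i)"
  have simple: "simple_graph (G i)" and ind: "G i = induced (G 0) (verts (G i))"
    using network_induced[OF net] by blast+
  have nbhd: "insert x (nbrs (G i) x) \<subseteq> verts (G i)" if "x \<in> verts (G i)" for x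
    using that nbrs_subset_verts[OF simple] by blast
  have "(\<exists>x\<in>insert v (nbrs (G i) v). MemDetect H (induced (G 0) (insert x (nbrs (G i) x))) v)
    \<longleftrightarrow> MemDetect H (G i) v" (is "?lhs \<longleftrightarrow> ?rhs")
  proof
    assume ?lhs
    then obtain x where "x \<in> verts (G i)"
      "MemDetect H (induced (G 0) (insert x (nbrs (G i) x))) v"
      using nbhd[OF v] by blast
    then show ?rhs
      \<comment> \<open>Soundness: the closed neighborhood of \<open>x\<close> consists of surviving
        nodes, so a copy found there lies in \<open>G i\<close>.\<close>
      using MemDetect_mono nbhd ind by metis
  next
    assume ?rhs
    then obtain x where x: "v \<in> insert x (nbrs (G i) x)"
      "MemDetect H (induced (G i) (insert x (nbrs (G i) x))) v"
      using MemDetect_closed_nbhd[OF assms] by blast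
    \<comment> \<open>Completeness: adjacency is symmetric, so \<open>v\<close> is either the center
      \<open>x\<close> itself or receives its bit.\<close>
    have "x \<in> insert v (nbrs (G i) v)"
      using x(1) by (auto simp: nbrs_def insert_commute)
    \<comment> \<open>Restricting \<open>G i\<close> amounts to restricting \<open>G 0\<close> to an
      intersection; monotonicity then drops the factor \<open>verts (G i)\<close>.\<close>
    moreover have "MemDetect H (induced (G 0) (insert x (nbrs (G i) x))) v"
      using x(2) ind induced_induced MemDetect_mono by (metis inf_le2)
    ultimately show ?lhs by blast
  qed
  then show "result (detect_alg H) v (G 0) (history_of (detect_alg H) G i v) \<longleftrightarrow>
      MemDetect H (G i) v"
    \<comment> \<open>Since \<open>i\<close> is at least 1, the history is nonempty and its last
      entry is the current round.\<close>
    using i result_detect_alg[of H v G] by (cases i) auto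
qed

theorem theorem6p7:
  fixes H :: "'a ugraph"
  assumes "simple_graph H"
    and "connected_graph H"
    and "card (verts H) \<ge> 3"
    and "diam H = 2"
    and "rad H = 1"
  shows "\<exists>B A. has_bandwidth A B \<and> one_round_solves A (MemDetect H)"
proof (intro exI conjI)
  show "has_bandwidth (detect_alg H) 1"
    by (simp add: has_bandwidth_def detect_alg_def)
  show "one_round_solves (detect_alg H) (MemDetect H)"
    using assms(5) by (rule detect_alg_correct)
qed

end
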